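(* Let $j\in\mathbb{Z}\setminus\{0\}$ and let $r_{k,n}^j=\mathbb{P}\{T_n=k,\,S_n=j\}$. This probability admits the following expression, for $0\le k\le n$ such that $n-k$ is even. (i) If $j\ge 1$: $$r_{k,n}^j=\begin{cases}\displaystyle 2j\sum_{\substack{i\in\mathbb{N}:\ j\le i\le k,\\ i-j\in\mathcal{E}}}\frac{a_{n-i}}{i}\binom{i}{(i+j)/2}\,p^{(n+j)/2}q^{(n-j)/2}&\text{if } j\le k \text{ and } k-j \text{ is even},\\[2ex] 0&\text{if } j>k \text{ or } k-j\text{ is odd.}\end{cases}$$ (ii) If $j\le -1$: $$r_{k,n}^j=\begin{cases}\displaystyle 2|j|\sum_{\substack{i\in\mathbb{N}:\ |j|\le i\le k,\\ i+j\in\mathcal{E}}}\frac{a_{n-i}}{i}\binom{i}{(i+j)/2}\,p^{(n+j)/2}q^{(n-j)/2}&\text{if } j\ge k-n \text{ and } k-j \text{ is even},\\[2ex] 0&\text{if } j<k-n \text{ or } k-j\text{ is odd.}\end{cases}$$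
   Context: Let $p\in(0,1)$, $q=1-p$, and let $(X_k)_{k\ge1}$ be independent random variables with $\mathbb{P}\{X_k=1\}=p$, $\mathbb{P}\{X_k=-1\}=q$. Let $S_0=0$ and $S_k=\sum_{j=1}^kX_j$ for $k\ge1$ (Bernoulli random walk on $\mathbb{Z}$). The modified sojourn time is $T_0=0$ and $T_n=\sum_{j=1}^n\delta_j$ for $n\ge1$, where $\delta_j=1$ if ($S_j>0$) or ($S_j=0$ and $S_{j-1}>0$), and $\delta_j=0$ if ($S_j<0$) or ($S_j=0$ and $S_{j-1}<0$). Notation: $\mathbb{N}=\{0,1,2,\dots\}$, $\mathcal{E}=\{0,2,4,\dots\}$, and $a_i=\frac{1}{i+2}\binom{i}{i/2}$ for $i\in\mathcal{E}$.
   Formalization: In (ii) the sum runs to i ≤ n−k, not i ≤ k, and is claimed if j ≥ k−n, k even, n−k−j even, else r=0; (ii) covers n−k even or k even. As printed (ii) fails: n=2, k=0, j=−2 gives 0, true value q². *)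

theory Defs
  imports "HOL-Probability.Probability"
begin

(* Steps are indexed from 1; the value x 0 is never used. *)
definition walk :: "(nat \<Rightarrow> int) \<Rightarrow> nat \<Rightarrow> int" where
  "walk x n = (\<Sum>i=1..n. x i)"

(* Used for i >= 1 only. For steps with values 1 and -1 the walk cannot be at 0 at two
   consecutive times, so the value 0 is taken exactly when the walk is negative at time i, or
   is at 0 at time i and negative at time i - 1. *)
definition pos_step :: "(nat \<Rightarrow> int) \<Rightarrow> nat \<Rightarrow> nat" where
  "pos_step x i =
     (if walk x i > 0 \<or> (walk x i = 0 \<and> walk x (i - 1) > 0) then 1 else 0)"

definition sojourn :: "(nat \<Rightarrow> int) \<Rightarrow> nat \<Rightarrow> nat" where
  "sojourn x n = (\<Sum>i=1..n. pos_step x i)"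

(* Only meaningful for even i. *)
definition a_coeff :: "nat \<Rightarrow> real" where
  "a_coeff i = real (i choose (i div 2)) / real (i + 2)"

definition joint_prob ::
    "'a measure \<Rightarrow> (nat \<Rightarrow> 'a \<Rightarrow> int) \<Rightarrow> nat \<Rightarrow> nat \<Rightarrow> int \<Rightarrow> real" where
  "joint_prob M X k n j =
     measure M {\<omega> \<in> space M. sojourn (\<lambda>i. X i \<omega>) n = k \<and> walk (\<lambda>i. X i \<omega>) n = j}"

end

theory Submission
  imports Defs
begin

text \<open>
  Conditioning on the last step gives a linear recursion in \<open>n\<close> for the joint law of
  \<open>(T\<^sub>n, S\<^sub>n)\<close>, so it suffices that the claimed expression solves it. Up to the weight
  \<open>p\<close> to the number of up-steps times \<open>q\<close> to the number of down-steps, that expression is a sum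
  over the length \<open>i\<close> of the part of the path after its last zero: a bridge of length \<open>n - i\<close>,
  whose sojourn time is uniformly distributed over the even numbers from \<open>0\<close> to \<open>n - i\<close>, followed
  by a path of length \<open>i\<close> that does not return to \<open>0\<close>. Away from \<open>j = 0\<close> the recursion
  reduces to that of the ballot numbers; at \<open>j = 0\<close> it is the Catalan convolution.
\<close>

section \<open>Ballot numbers\<close>

text \<open>The number of paths of length \<open>i\<close> from \<open>0\<close> to \<open>j\<close> that are positive after time \<open>0\<close>.\<close>

fun ballot :: "nat \<Rightarrow> nat \<Rightarrow> real" where
  "ballot 0 j = (if j = 0 then 1 else 0)"
| "ballot (Suc i) 0 = 0"
| "ballot (Suc i) (Suc j) = ballot i j + ballot i (Suc (Suc j))"

lemma ballot_eq_0: "i < j \<or> odd (i + j) \<Longrightarrow> ballot i j = 0"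
  by (induction i j rule: ballot.induct) (auto intro: gr0I)

text \<open>The ballot theorem with its division cleared; \<open>d\<close> is the number of
  down-steps. Induction on the length expresses both terms of the ballot recursion through the one
  binomial \<open>c\<close>.\<close>

lemma ballot_times: "real (j + 2 * d) * ballot (j + 2 * d) j = real j * real ((j + 2 * d) choose d)"
proof (induction "j + 2 * d" arbitrary: j d)
  case 0
  then show ?case by simp
next
  case (Suc N)
  show ?case
  proof (cases j)
    case 0
    then show ?thesis using Suc.hyps(2) by (cases d) auto
  next
    case (Suc j')
    have N: "N = j' + 2 * d" using Suc Suc.hyps(2) by simp
    show ?thesis
    proof (cases "N = 0")
      case True
      then show ?thesis using N Suc by simp
    next
      case False
      have 1: "real N * ballot N j' = real j' * real (N choose d)"
        using Suc.hyps(1)[OF N] N by simp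
      define c where "c = real (Suc N choose d)"
      have A: "real (Suc N) * real (N choose d) = (real j + real d) * c"
      proof -
        have "(Suc N - d) * (Suc N choose d) = Suc N * (N choose d)"
          using binomial_absorb_comp[of "Suc N" d] by simp
        then have "real (Suc N - d) * c = real (Suc N) * real (N choose d)"
          unfolding c_def by (metis of_nat_mult)
        moreover have "Suc N - d = j + d" using N Suc by simp
        ultimately show ?thesis by simp
      qed
      have B: "real (Suc N) * (real N * ballot N (Suc j)) = (real j + 1) * (real d * c)"
      proof (cases d)
        case 0
        then have "ballot N (Suc j) = 0" using N Suc by (intro ballot_eq_0) auto
        then show ?thesis using 0 by simp
      next
        case (Suc d')
        have e: "N = Suc j + 2 * d'" using N Suc \<open>j = Suc j'\<close> by simp
        have "Suc N * (N choose d') = (Suc N choose Suc d') * Suc d'"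
          by (rule Suc_times_binomial_eq)
        then have "real (Suc N) * real (N choose d') = real d * c"
          unfolding c_def Suc by (metis of_nat_mult mult.commute)
        moreover have "real N * ballot N (Suc j) = (real j + 1) * real (N choose d')"
          using Suc.hyps(1)[OF e] e by simp
        ultimately show ?thesis by (metis mult.left_commute)
      qed
      have "real N * (real (Suc N) * ballot (Suc N) j)
          = real (Suc N) * (real N * ballot N j') + real (Suc N) * (real N * ballot N (Suc j))"
        using Suc by (simp add: algebra_simps)
      also have "\<dots> = (real j - 1) * (real (Suc N) * real (N choose d)) + (real j + 1) * (real d * c)"
        unfolding 1 B using Suc by simp
      \<comment> \<open>Since \<open>N = j + 2 * d - 1\<close>, one has
        \<open>(j - 1) * (j + d) + (j + 1) * d = N * j\<close>; the nonzero factor \<open>N\<close>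
        then cancels.\<close>
      also have "\<dots> = real N * (real j * c)"
        unfolding A using N Suc by (simp add: algebra_simps)
      finally show ?thesis using False Suc.hyps(2) c_def by simp
    qed
  qed
qed

section \<open>Catalan numbers and their convolution\<close>

definition catalan :: "nat \<Rightarrow> real" where
  "catalan n = real ((2 * n) choose n) / (real n + 1)"

lemma catalan_0 [simp]: "catalan 0 = 1"
  by (simp add: catalan_def)

lemma catalan_Suc: "(real n + 2) * catalan (Suc n) = (4 * real n + 2) * catalan n"
proof -
  have 1: "Suc n * (Suc (Suc (2 * n)) choose Suc n) = Suc (Suc (2 * n)) * (Suc (2 * n) choose n)"
    by (rule Suc_times_binomial)
  have 2: "(Suc (2 * n) - n) * (Suc (2 * n) choose n) = Suc (2 * n) * (2 * n choose n)"
    using binomial_absorb_comp[of "Suc (2 * n)" n] by simp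
  have "Suc n * (Suc (Suc (2 * n)) choose Suc n) = 2 * (Suc (2 * n) * (2 * n choose n))"
    unfolding 1 2[symmetric] by simp
  then have "real (Suc n) * real (Suc (Suc (2 * n)) choose Suc n)
      = 2 * (real (Suc (2 * n)) * real (2 * n choose n))"
    by (metis of_nat_mult of_nat_numeral)
  moreover have "catalan (Suc n) = real (Suc (Suc (2 * n)) choose Suc n) / (real n + 2)"
    by (simp add: catalan_def add.commute del: binomial_Suc_Suc)
  ultimately show ?thesis
    by (simp add: catalan_def field_simps del: binomial_Suc_Suc)
qed

text \<open>The symmetrization \<open>2 * T n = n * S n\<close> together with the two-term recursion
  \<open>catalan_Suc\<close> turns the quadratic convolution into a first-order recursion.\<close>

lemma catalan_convolution: "(\<Sum>l\<le>m. catalan l * catalan (m - l)) = catalan (Suc m)"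
proof (induction m)
  case 0
  then show ?case using catalan_Suc[of 0] by simp
next
  case (Suc m)
  define S where "S n = (\<Sum>l\<le>n. catalan l * catalan (n - l))" for n
  define T where "T n = (\<Sum>l\<le>n. real l * catalan l * catalan (n - l))" for n
  have T: "2 * T n = real n * S n" for n
  proof -
    have "T n = (\<Sum>l\<le>n. real (n - l) * catalan l * catalan (n - l))"
      unfolding T_def by (rule sum.reindex_bij_witness[of _ "\<lambda>l. n - l" "\<lambda>l. n - l"]) auto
    then have "2 * T n = (\<Sum>l\<le>n. real l * catalan l * catalan (n - l) +
        real (n - l) * catalan l * catalan (n - l))"
      by (simp add: sum.distrib T_def)
    also have "\<dots> = (\<Sum>l\<le>n. real n * (catalan l * catalan (n - l)))"
      by (intro sum.cong) (auto simp: of_nat_diff algebra_simps)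
    finally show ?thesis by (simp add: S_def sum_distrib_left)
  qed
  \<comment> \<open>The weight \<open>l + 1\<close> of this sum becomes, after an index shift, the
    factor \<open>l + 2\<close> that \<open>catalan_Suc\<close> can absorb.\<close>
  have "T (Suc m) + S (Suc m) = (\<Sum>l\<le>Suc m. (real l + 1) * catalan l * catalan (Suc m - l))"
    by (simp add: T_def S_def sum.distrib[symmetric] algebra_simps)
  also have "\<dots> = catalan (Suc m) + (\<Sum>l\<le>m. (real l + 2) * catalan (Suc l) * catalan (m - l))"
    by (subst sum.atMost_Suc_shift) (simp add: algebra_simps)
  also have "\<dots> = catalan (Suc m) + (4 * T m + 2 * S m)"
    unfolding catalan_Suc
    by (simp add: T_def S_def sum_distrib_left sum.distrib[symmetric] algebra_simps)
  finally have "(real m + 3) * S (Suc m) = 2 * catalan (Suc m) + (4 * real m + 4) * S m"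
    using T[of m] T[of "Suc m"] by (simp add: algebra_simps)
  also have "S m = catalan (Suc m)" using Suc by (simp add: S_def)
  also have "2 * catalan (Suc m) + (4 * real m + 4) * catalan (Suc m) 
     = (real m + 3) * catalan (Suc (Suc m))"
    using catalan_Suc[of "Suc m"] by (simp add: algebra_simps)
  finally show ?case by (simp add: S_def)
qed

section \<open>Bridges and the decomposition at the last zero\<close>

text \<open>The number of paths of length \<open>m\<close> from \<open>0\<close> to \<open>0\<close> with a prescribed sojourn time, which is
  the same for every even value of that time in \<open>{0..m}\<close>.\<close>

definition bridge :: "nat \<Rightarrow> real" where
  "bridge m = (if even m then 2 * a_coeff m else 0)"

text \<open>The \<open>2 * l choose l\<close> bridges split evenly over the \<open>l + 1\<close>
  possible sojourn times (Chung-Feller), so the share of each is a Catalan number.\<close>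

lemma bridge_double: "bridge (2 * l) = catalan l"
  by (simp add: bridge_def a_coeff_def catalan_def field_simps)

lemma bridge_odd: "odd m \<Longrightarrow> bridge m = 0"
  by (simp add: bridge_def)

text \<open>Here \<open>k\<close> is the time spent on the side of 0 where the path ends. The final
  part of length \<open>i\<close> lies on that side, so \<open>i \<le> k\<close>; the bridge spends
  the other \<open>k - i\<close> there, and its count does not depend on that value. The parity of
  \<open>k - i\<close> is left to \<open>path_count\<close>.\<close>

definition last_zero_sum :: "nat \<Rightarrow> nat \<Rightarrow> nat \<Rightarrow> real" where
  "last_zero_sum k n j = (\<Sum>i\<le>k. bridge (n - i) * ballot i j)"

lemma last_zero_sum_at_0: "last_zero_sum k n 0 = bridge n"
proof -
  have "last_zero_sum k n 0 = (\<Sum>i\<in>{0}. bridge (n - i) * ballot i 0)"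
    unfolding last_zero_sum_def
  proof (rule sum.mono_neutral_right)
    show "\<forall>i\<in>{..k} - {0}. bridge (n - i) * ballot i 0 = 0"
      using gr0_conv_Suc by auto
  qed auto
  then show ?thesis by simp
qed

lemma last_zero_sum_0_Suc: "last_zero_sum 0 n (Suc j) = 0"
  by (simp add: last_zero_sum_def)

text \<open>Dropping the last step shortens the final part by one and leaves the bridge length
  \<open>n - i\<close> unchanged; the term with \<open>i = 0\<close> vanishes at a positive
  height.\<close>

lemma last_zero_sum_Suc:
  "last_zero_sum (Suc k) (Suc n) (Suc j) = last_zero_sum k n j + last_zero_sum k n (Suc (Suc j))"
  unfolding last_zero_sum_def
  by (subst sum.atMost_Suc_shift) (simp add: algebra_simps sum.distrib[symmetric])

lemma last_zero_sum_eq_0: "odd (n + j) \<Longrightarrow> k \<le> n \<Longrightarrow> last_zero_sum k n j = 0"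
  unfolding last_zero_sum_def
proof (rule sum.neutral, rule ballI)
  fix i assume "odd (n + j)" "k \<le> n" "i \<in> {..k}"
  then have "odd (n - i) \<or> odd (i + j)" by auto
  then show "bridge (n - i) * ballot i j = 0"
    by (auto simp: bridge_odd ballot_eq_0)
qed

lemma ballot_1: "ballot (Suc (2 * l)) 1 = catalan l"
proof -
  have "real (Suc (2 * l)) * ballot (Suc (2 * l)) 1 = real (Suc (2 * l) choose l)"
    using ballot_times[of 1 l] by simp
  moreover have "real (Suc l) * real (Suc (2 * l) choose l) = real (Suc (2 * l)) * real (2 * l choose l)"
  proof -
    have "(Suc (2 * l) - l) * (Suc (2 * l) choose l) = Suc (2 * l) * (2 * l choose l)"
      using binomial_absorb_comp[of "Suc (2 * l)" l] by simp
    then have "Suc l * (Suc (2 * l) choose l) = Suc (2 * l) * (2 * l choose l)" by simp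
    then show ?thesis by (metis of_nat_mult)
  qed
  ultimately have "real (Suc (2 * l)) * (real (Suc l) * ballot (Suc (2 * l)) 1) =
      real (Suc (2 * l)) * real (2 * l choose l)"
    by (metis mult.left_commute)
  then have "real (Suc l) * ballot (Suc (2 * l)) 1 = real (2 * l choose l)"
    by (simp only: mult_cancel_left of_nat_eq_0_iff) simp
  then show ?thesis by (simp add: catalan_def field_simps del: ballot.simps)
qed

text \<open>Ballot paths to 1 have odd length, so of the \<open>2 * a\<close> indices only
  \<open>i = 2 * l + 1\<close> with \<open>l < a\<close> contribute, each a product of two Catalan
  numbers.\<close>

lemma bridge_ballot_sum:
  assumes "a \<le> Suc m"
  shows "(\<Sum>i<2 * a. bridge (Suc (2 * m) - i) * ballot i 1) = (\<Sum>l<a. catalan l * catalan (m - l))"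
  using assms
proof (induction a)
  case (Suc a)
  have "ballot (2 * a) 1 = 0" by (intro ballot_eq_0) simp
  moreover have "bridge (Suc (2 * m) - Suc (2 * a)) = catalan (m - a)"
    using bridge_double[of "m - a"] by (simp add: diff_mult_distrib2)
  ultimately show ?case using Suc ballot_1[of a] by (simp add: mult.commute del: ballot.simps)
qed simp

text \<open>Reflecting the summation index in the second sum turns the two partial sums into the two
  complementary pieces of a single Catalan convolution.\<close>

lemma last_zero_sum_bridge:
  assumes "even k" "k \<le> Suc n" "odd n"
  shows "(if k = 0 then 0 else last_zero_sum (k - 1) n 1) +
    (if k = Suc n then 0 else last_zero_sum (n - k) n 1) = bridge (Suc n)"
proof -
  obtain m where n: "n = Suc (2 * m)" using \<open>odd n\<close> by (auto elim: oddE)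
  obtain a where k: "k = 2 * a" using \<open>even k\<close> by (auto elim: evenE)
  have a: "a \<le> Suc m" using assms n k by simp
  define c where "c l = catalan l * catalan (m - l)" for l
  have 1: "(if k = 0 then 0 else last_zero_sum (k - 1) n 1) = (\<Sum>l<a. c l)"
    using bridge_ballot_sum[OF a] unfolding last_zero_sum_def k n c_def
    by (cases a) (auto simp: lessThan_Suc_atMost[symmetric])
  have 2: "(if k = Suc n then 0 else last_zero_sum (n - k) n 1) = (\<Sum>l<Suc m - a. c l)"
  proof (cases "k = Suc n")
    case False
    then have "{..n - k} = {..<2 * (Suc m - a)}" using a n k by auto
    then show ?thesis
      using False bridge_ballot_sum[of "Suc m - a" m] unfolding last_zero_sum_def n c_def by simp
  qed (use n k in auto)
  also have "\<dots> = (\<Sum>l\<in>{a..<Suc m}. c l)"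
    by (rule sum.reindex_bij_witness[of _ "\<lambda>l. m - l" "\<lambda>l. m - l"])
      (use a in \<open>auto simp: c_def mult.commute\<close>)
  finally have "(if k = 0 then 0 else last_zero_sum (k - 1) n 1) +
      (if k = Suc n then 0 else last_zero_sum (n - k) n 1) = (\<Sum>l<a. c l) + (\<Sum>l\<in>{a..<Suc m}. c l)"
    using 1 by simp
  also have "\<dots> = (\<Sum>l\<le>m. c l)"
    using a sum.atLeastLessThan_concat[of 0 a "Suc m" c]
    by (simp add: atLeast0LessThan lessThan_Suc_atMost)
  also have "\<dots> = bridge (2 * Suc m)"
    unfolding c_def bridge_double by (rule catalan_convolution)
  finally show ?thesis by (simp add: n)
qed

section \<open>The recursion for the path counts\<close>

text \<open>The number of paths of length \<open>n\<close> with sojourn time \<open>k\<close> that end at \<open>j\<close>.\<close>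

definition path_count :: "nat \<Rightarrow> nat \<Rightarrow> int \<Rightarrow> real" where
  "path_count k n j =
     (if n < k then 0
      else if 0 \<le> j then (if even (n - k) then last_zero_sum k n (nat j) else 0)
      else (if even k then last_zero_sum (n - k) n (nat (- j)) else 0))"

lemma path_count_0: "path_count k 0 j = (if k = 0 \<and> j = 0 then 1 else 0)"
  by (auto simp: path_count_def last_zero_sum_def bridge_def a_coeff_def)

text \<open>At \<open>j = 0\<close> the two branches of \<open>path_count\<close> agree: both give
  \<open>bridge n\<close>, which vanishes for odd \<open>n\<close>, while for even \<open>n\<close>
  the parities of \<open>n - k\<close> and \<open>k\<close> coincide.\<close>

lemma path_count_nonpos:
  assumes "j \<le> 0"
  shows "path_count k n j = (if n < k \<or> odd k then 0 else last_zero_sum (n - k) n (nat (- j)))"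
  using assms by (auto simp: path_count_def last_zero_sum_at_0 bridge_odd)

text \<open>An up-step into \<open>j\<close> counts as positive time exactly when
  \<open>0 < j\<close>. A down-step counts exactly when \<open>0 \<le> j\<close>, because at
  \<open>j = 0\<close> it comes from 1. The guards on \<open>k = 0\<close> exclude the truncated
  \<open>k - 1\<close>.\<close>

lemma path_count_Suc:
  "path_count k (Suc n) j =
     (if 0 < j then (if k = 0 then 0 else path_count (k - 1) n (j - 1)) else path_count k n (j - 1)) +
     (if 0 \<le> j then (if k = 0 then 0 else path_count (k - 1) n (j + 1)) else path_count k n (j + 1))"
proof -
  consider "0 < j" | "j = 0" | "j < 0" by linarith
  then show ?thesis
  proof cases
    case 1
    then obtain i where i: "j = int (Suc i)"
      by (metis Suc_pred' nat_0_less_mult_iff of_nat_0_less_iff zero_less_imp_eq_int)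
    have ji: "j - 1 = int i" "j + 1 = int (Suc (Suc i))" using i by simp_all
    show ?thesis
    proof (cases k)
      case 0
      then show ?thesis using 1 unfolding path_count_def i nat_int by (simp add: last_zero_sum_0_Suc)
    next
      case (Suc k')
      then show ?thesis using 1 unfolding ji path_count_def unfolding i nat_int by (simp add: last_zero_sum_Suc)
    qed
  next
    case 3
    then obtain i where i: "j = - int (Suc i)"
      by (metis Suc_pred' minus_equation_iff neg_0_less_iff_less of_nat_0_less_iff zero_less_imp_eq_int)
    have ji: "j - 1 = - int (Suc (Suc i))" "j + 1 = - int i" using i by simp_all
    have le: "- int l \<le> 0" for l by simp
    \<comment> \<open>At \<open>k = Suc n\<close> the time left for the negative side is 0 and the
      count vanishes; \<open>Suc n - k = Suc (n - k)\<close> holds only for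
      \<open>k \<le> n\<close>.\<close>
    consider "Suc n < k" | "k = Suc n" | "k \<le> n" by linarith
    then show ?thesis
      using 3 unfolding ji unfolding i path_count_nonpos[OF le] minus_minus nat_int
      by cases (auto simp: last_zero_sum_0_Suc Suc_diff_le last_zero_sum_Suc)
  next
    case 2
    have L: "path_count k (Suc n) 0 = (if Suc n < k \<or> odd k then 0 else bridge (Suc n))"
      using path_count_nonpos[of 0 k "Suc n"] by (simp add: last_zero_sum_at_0)
    have A: "path_count k n (- 1) = (if n < k \<or> odd k then 0 else last_zero_sum (n - k) n 1)"
      using path_count_nonpos[of "- 1" k n] by simp
    have B: "path_count (k - 1) n 1 =
        (if n < k - 1 \<or> odd (n - (k - 1)) then 0 else last_zero_sum (k - 1) n 1)"
      unfolding path_count_def by (simp del: One_nat_def even_diff_nat) simp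
    consider "Suc n < k" | "k \<le> Suc n" "even n" | "k \<le> Suc n" "odd n" "odd k"
      | "k \<le> Suc n" "odd n" "even k" by linarith
    then show ?thesis
    proof cases
      case 1
      then show ?thesis using 2 L A B by auto
    next
      case c: 2
      \<comment> \<open>After an even number of steps neither 1 nor -1 can be reached, and there is
        no bridge of odd length: both sides are 0.\<close>
      have "last_zero_sum l n (Suc 0) = 0" if "l \<le> n" for l
        using last_zero_sum_eq_0[of n 1 l] c that by simp
      then show ?thesis using 2 L A B c by (auto simp: bridge_odd)
    next
      case 3
      then show ?thesis using 2 L A B by auto
    next
      case 4
      \<comment> \<open>Arrival from 1 uses \<open>k - 1\<close>, arrival from -1 uses
        \<open>k\<close>; the two counts together make up the bridge count.\<close>
      then show ?thesis using 2 L A B last_zero_sum_bridge[of k n] by (auto split: if_splits)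
    qed
  qed
qed

section \<open>The joint law and its recursion\<close>

lemma walk_Suc: "walk x (Suc n) = walk x n + x (Suc n)"
  by (simp add: walk_def)

lemma sojourn_Suc: "sojourn x (Suc n) = sojourn x n + pos_step x (Suc n)"
  by (simp add: sojourn_def)

lemma walk_restrict: "m \<le> n \<Longrightarrow> walk (restrict x {1..n}) m = walk x m"
  by (auto simp: walk_def intro!: sum.cong)

lemma sojourn_restrict: "sojourn (restrict x {1..n}) n = sojourn x n"
  unfolding sojourn_def
proof (rule sum.cong)
  fix i assume "i \<in> {1..n}"
  then have "i \<le> n" "i - 1 \<le> n" by auto
  then show "pos_step (restrict x {1..n}) i = pos_step x i"
    by (simp only: pos_step_def walk_restrict)
qed simp

text \<open>The sojourn time and the walk at time \<open>n\<close> are functions of the steps in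
  \<open>{1..n}\<close>, a block of coordinates independent of the block
  \<open>{Suc n}\<close>.\<close>

lemma (in prob_space) prob_history_and_next:
  fixes X :: "nat \<Rightarrow> 'a \<Rightarrow> int"
  assumes "indep_vars (\<lambda>_. count_space UNIV) X {1..}"
  shows "prob {\<omega> \<in> space M. sojourn (\<lambda>i. X i \<omega>) n = k \<and> walk (\<lambda>i. X i \<omega>) n = j \<and> X (Suc n) \<omega> = s}
      = joint_prob M X k n j * prob {\<omega> \<in> space M. X (Suc n) \<omega> = s}"
    and "{\<omega> \<in> space M. sojourn (\<lambda>i. X i \<omega>) n = k \<and> walk (\<lambda>i. X i \<omega>) n = j} \<in> events"
    and "{\<omega> \<in> space M. X (Suc n) \<omega> = s} \<in> events"
proof -
  let ?S = "\<lambda>I. PiM I (\<lambda>_. count_space UNIV) :: (nat \<Rightarrow> int) measure"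
  \<comment> \<open>A finite product of these discrete spaces is discrete, so \<open>P\<close> and
    \<open>Q\<close> are measurable without further argument.\<close>
  have S: "?S I = count_space (PiE I (\<lambda>_. UNIV))" if "finite I" for I
    using that by (intro count_space_PiM_finite) auto
  let ?h = "\<lambda>I \<omega>. restrict (\<lambda>i. X i \<omega>) I"
  have ind: "indep_var (?S {1..n}) (?h {1..n}) (?S {Suc n}) (?h {Suc n})"
    using assms by (rule indep_var_restrict) auto
  define P where "P = {x \<in> PiE {1..n} (\<lambda>_. UNIV). sojourn x n = k \<and> walk x n = j}"
  define Q where "Q = {x \<in> PiE {Suc n} (\<lambda>_. UNIV). x (Suc n) = s}"
  have P: "P \<in> sets (?S {1..n})" and Q: "Q \<in> sets (?S {Suc n})"
    by (auto simp: S P_def Q_def)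
  have hP: "?h {1..n} -` P \<inter> space M =
      {\<omega> \<in> space M. sojourn (\<lambda>i. X i \<omega>) n = k \<and> walk (\<lambda>i. X i \<omega>) n = j}"
    unfolding P_def by (rule set_eqI)
      (simp only: vimage_eq Int_iff mem_Collect_eq sojourn_restrict walk_restrict[OF order_refl]
        restrict_PiE_iff UNIV_I ball_triv simp_thms conj_ac)
  have hQ: "?h {Suc n} -` Q \<inter> space M = {\<omega> \<in> space M. X (Suc n) \<omega> = s}"
    by (auto simp: Q_def)
  have "(\<lambda>x. (?h {1..n} x, ?h {Suc n} x)) -` (P \<times> Q) \<inter> space M =
      (?h {1..n} -` P \<inter> space M) \<inter> (?h {Suc n} -` Q \<inter> space M)"
    by auto
  also have "\<dots> = {\<omega> \<in> space M. sojourn (\<lambda>i. X i \<omega>) n = k \<and> walk (\<lambda>i. X i \<omega>) n = j \<and> X (Suc n) \<omega> = s}"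
    unfolding hP hQ by auto
  finally show "prob {\<omega> \<in> space M. sojourn (\<lambda>i. X i \<omega>) n = k \<and> walk (\<lambda>i. X i \<omega>) n = j \<and> X (Suc n) \<omega> = s}
      = joint_prob M X k n j * prob {\<omega> \<in> space M. X (Suc n) \<omega> = s}"
    using indep_varD[OF ind P Q] unfolding hP hQ joint_prob_def by simp
  show "{\<omega> \<in> space M. sojourn (\<lambda>i. X i \<omega>) n = k \<and> walk (\<lambda>i. X i \<omega>) n = j} \<in> events"
    using measurable_sets[OF indep_var_rv1[OF ind] P] unfolding hP .
  show "{\<omega> \<in> space M. X (Suc n) \<omega> = s} \<in> events"
    using measurable_sets[OF indep_var_rv2[OF ind] Q] unfolding hQ .
qed

lemma (in prob_space) joint_prob_Suc:
  fixes X :: "nat \<Rightarrow> 'a \<Rightarrow> int"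
  assumes ind: "indep_vars (\<lambda>_. count_space UNIV) X {1..}"
    and p: "prob {\<omega> \<in> space M. X (Suc n) \<omega> = 1} = p"
    and q: "prob {\<omega> \<in> space M. X (Suc n) \<omega> = - 1} = q"
    and pq: "p + q = 1"
  shows "joint_prob M X k (Suc n) j =
     (if 0 < j then (if k = 0 then 0 else joint_prob M X (k - 1) n (j - 1)) else joint_prob M X k n (j - 1)) * p +
     (if 0 \<le> j then (if k = 0 then 0 else joint_prob M X (k - 1) n (j + 1)) else joint_prob M X k n (j + 1)) * q"
proof -
  let ?x = "\<lambda>\<omega> i. X i \<omega>"
  let ?H = "\<lambda>k j s. {\<omega> \<in> space M. sojourn (?x \<omega>) n = k \<and> walk (?x \<omega>) n = j \<and> X (Suc n) \<omega> = s}"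
  note [measurable] = prob_history_and_next(2,3)[OF ind]
  define E where "E = {\<omega> \<in> space M. sojourn (?x \<omega>) (Suc n) = k \<and> walk (?x \<omega>) (Suc n) = j}"
  define U where "U = {\<omega> \<in> E. X (Suc n) \<omega> = 1}"
  define D where "D = {\<omega> \<in> E. X (Suc n) \<omega> = - 1}"
  have E [measurable]: "E \<in> events"
    unfolding E_def by (rule prob_history_and_next(2)[OF ind])
  have U_eq: "U = E \<inter> {\<omega> \<in> space M. X (Suc n) \<omega> = 1}"
    and D_eq: "D = E \<inter> {\<omega> \<in> space M. X (Suc n) \<omega> = - 1}"
    by (auto simp: U_def D_def E_def)
  have ev [measurable]: "U \<in> events" "D \<in> events"
    unfolding U_eq D_eq by simp_all
  \<comment> \<open>The steps may take other integer values, but \<open>p + q = 1\<close> confines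
    this to a null set, so \<open>E\<close> and \<open>U \<union> D\<close> agree almost
    everywhere.\<close>
  have "prob ({\<omega> \<in> space M. X (Suc n) \<omega> = 1} \<union> {\<omega> \<in> space M. X (Suc n) \<omega> = - 1}) = 1"
    by (subst finite_measure_Union) (use p q pq in auto)
  then have "AE \<omega> in M. \<omega> \<in> {\<omega> \<in> space M. X (Suc n) \<omega> = 1} \<union> {\<omega> \<in> space M. X (Suc n) \<omega> = - 1}"
    by (subst prob_eq_1[symmetric]) auto
  then have "AE \<omega> in M. \<omega> \<in> E \<longleftrightarrow> \<omega> \<in> U \<union> D"
    by eventually_elim (auto simp: U_def D_def)
  then have "prob E = prob (U \<union> D)"
    by (rule finite_measure_eq_AE) auto
  also have "\<dots> = prob U + prob D"
    by (rule finite_measure_Union) (auto simp: U_def D_def)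
  also have "prob U = (if 0 < j then (if k = 0 then 0 else joint_prob M X (k - 1) n (j - 1))
      else joint_prob M X k n (j - 1)) * p"
  proof -
    have "U = (if 0 < j then (if k = 0 then {} else ?H (k - 1) (j - 1) 1) else ?H k (j - 1) 1)"
      by (auto simp: U_def E_def sojourn_Suc walk_Suc pos_step_def)
    then show ?thesis by (simp add: prob_history_and_next(1)[OF ind] p)
  qed
  also have "prob D = (if 0 \<le> j then (if k = 0 then 0 else joint_prob M X (k - 1) n (j + 1))
      else joint_prob M X k n (j + 1)) * q"
  proof -
    have "D = (if 0 \<le> j then (if k = 0 then {} else ?H (k - 1) (j + 1) (- 1)) else ?H k (j + 1) (- 1))"
      by (auto simp: D_def E_def sojourn_Suc walk_Suc pos_step_def)
    then show ?thesis by (simp add: prob_history_and_next(1)[OF ind] q)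
  qed
  finally show ?thesis unfolding joint_prob_def E_def .
qed

lemma (in prob_space) joint_prob_0:
  "joint_prob M X k 0 j = (if k = 0 \<and> j = 0 then 1 else 0)"
  by (auto simp: joint_prob_def sojourn_def walk_def prob_space)

text \<open>All paths of length \<open>n\<close> ending at \<open>j\<close> have the same weight,
  with \<open>(n + j) / 2\<close> up-steps and \<open>(n - j) / 2\<close> down-steps; counts and
  probabilities therefore obey the same recursion.\<close>

lemma (in prob_space) joint_prob_eq_path_count:
  fixes X :: "nat \<Rightarrow> 'a \<Rightarrow> int"
  assumes ind: "indep_vars (\<lambda>_. count_space UNIV) X {1..}"
    and p: "\<And>i. 1 \<le> i \<Longrightarrow> prob {\<omega> \<in> space M. X i \<omega> = 1} = p"
    and q: "\<And>i. 1 \<le> i \<Longrightarrow> prob {\<omega> \<in> space M. X i \<omega> = - 1} = q"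
    and pq: "p + q = 1" "p \<noteq> 0" "q \<noteq> 0"
  shows "joint_prob M X k n j =
    path_count k n j * (p powi ((int n + j) div 2) * q powi ((int n - j) div 2))"
proof (induction n arbitrary: k j)
  case 0
  show ?case by (auto simp: joint_prob_0 path_count_0)
next
  case (Suc n)
  \<comment> \<open>Integer exponents make the rules \<open>up\<close> and \<open>down\<close> hold
    for every \<open>j\<close>, even for \<open>\<bar>j\<bar> > n\<close>, where natural exponents
    would truncate. The relevant numerator grows by exactly 2, so the rounding in \<open>div\<close>
    is harmless.\<close>
  define w where "w n j = p powi ((int n + j) div 2) * q powi ((int n - j) div 2)" for n j
  have up: "w n (j - 1) * p = w (Suc n) j"
  proof -
    have e: "(int (Suc n) + j) div 2 = (int n + (j - 1)) div 2 + 1"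
      "int (Suc n) - j = int n - (j - 1)" by simp_all
    show ?thesis unfolding w_def e using pq by (simp add: power_int_add del: diff_diff_eq2)
  qed
  have down: "w n (j + 1) * q = w (Suc n) j"
  proof -
    have e: "(int (Suc n) - j) div 2 = (int n - (j + 1)) div 2 + 1"
      "int (Suc n) + j = int n + (j + 1)" by simp_all
    show ?thesis unfolding w_def e using pq by (simp add: power_int_add)
  qed
  have IH: "joint_prob M X k n j = path_count k n j * w n j" for k j
    using Suc unfolding w_def by blast
  have "joint_prob M X k (Suc n) j =
     (if 0 < j then (if k = 0 then 0 else path_count (k - 1) n (j - 1)) else path_count k n (j - 1)) * (w n (j - 1) * p) +
     (if 0 \<le> j then (if k = 0 then 0 else path_count (k - 1) n (j + 1)) else path_count k n (j + 1)) * (w n (j + 1) * q)"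
    using joint_prob_Suc[OF ind p q pq(1)] by (simp add: IH)
  also have "\<dots> = path_count k (Suc n) j * w (Suc n) j"
    unfolding up down path_count_Suc[of k n j] by (simp add: distrib_right)
  finally show ?case unfolding w_def .
qed

section \<open>The closed form\<close>

text \<open>Both forms are used: with \<open>m = \<bar>j\<bar>\<close>, the number
  \<open>(i + j) / 2\<close> of up-steps is \<open>(i + m) / 2\<close> for positive \<open>j\<close>
  and \<open>(i - m) / 2\<close> for negative \<open>j\<close>.\<close>

lemma ballot_eq:
  assumes "0 < i" "j \<le> i" "even (i + j)"
  shows "ballot i j = real j / real i * real (i choose ((i - j) div 2))"
    and "ballot i j = real j / real i * real (i choose ((i + j) div 2))"
proof -
  obtain d where d: "i = j + 2 * d"
    using assms by (metis dvd_diff_nat even_add evenE le_add_diff_inverse)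
  show 1: "ballot i j = real j / real i * real (i choose ((i - j) div 2))"
  proof -
    have d': "(i - j) div 2 = d" by (simp add: d)
    have "real i * ballot i j = real j * real (i choose d)"
      using ballot_times[of j d] by (simp only: d)
    then show ?thesis using assms(1) d' by (simp add: eq_divide_eq mult.commute)
  qed
  have "(i + j) div 2 = i - (i - j) div 2" by (simp add: d)
  then show "ballot i j = real j / real i * real (i choose ((i + j) div 2))"
    unfolding 1 by (simp add: binomial_symmetric[of "(i - j) div 2" i])
qed

lemma last_zero_sum_eq:
  assumes "0 < j" "even (n + j)" "k \<le> n"
  shows "last_zero_sum k n j = (\<Sum>i | j \<le> i \<and> i \<le> k \<and> even (i + j). 2 * a_coeff (n - i) * ballot i j)"
proof -
  have "last_zero_sum k n j = (\<Sum>i | j \<le> i \<and> i \<le> k \<and> even (i + j). bridge (n - i) * ballot i j)"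
    unfolding last_zero_sum_def
    by (rule sum.mono_neutral_right) (auto simp: not_le intro!: ballot_eq_0)
  also have "\<dots> = (\<Sum>i | j \<le> i \<and> i \<le> k \<and> even (i + j). 2 * a_coeff (n - i) * ballot i j)"
    by (rule sum.cong) (use assms in \<open>auto simp: bridge_def\<close>)
  finally show ?thesis .
qed

lemma last_zero_sum_less: "k < j \<Longrightarrow> last_zero_sum k n j = 0"
  by (simp add: last_zero_sum_def ballot_eq_0)

text \<open>For negative \<open>j\<close> the final part lies below 0, so the sojourn time
  \<open>k\<close> is accrued entirely in the bridge of length \<open>n - i\<close>; hence
  \<open>k\<close> is even and \<open>i \<le> n - k\<close>.\<close>

theorem theorem4p2:
  fixes M :: "'a measure" and X :: "nat \<Rightarrow> 'a \<Rightarrow> int"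
    and p q :: real and k n :: nat and j :: int
  assumes "prob_space M"
    and "0 < p" and "p < 1" and "q = 1 - p"
    and "prob_space.indep_vars M (\<lambda>_. count_space UNIV) X {1..}"
    and "\<And>i. 1 \<le> i \<Longrightarrow> measure M {\<omega> \<in> space M. X i \<omega> = 1} = p"
    and "\<And>i. 1 \<le> i \<Longrightarrow> measure M {\<omega> \<in> space M. X i \<omega> = - 1} = q"
    and "j \<noteq> 0" and "k \<le> n"
  shows "(j \<ge> 1 \<and> even (n - k) \<longrightarrow>
           joint_prob M X k n j =
             (if j \<le> int k \<and> even (int k - j)
              then 2 * real_of_int j *
                (\<Sum>i \<in> {i::nat. j \<le> int i \<and> i \<le> k \<and> even (int i - j)}.
                   a_coeff (n - i) / real i * real (i choose nat ((int i + j) div 2))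
                   * p ^ nat ((int n + j) div 2) * q ^ nat ((int n - j) div 2))
              else 0))
       \<and> (j \<le> - 1 \<and> (even (n - k) \<or> even k) \<longrightarrow>
           joint_prob M X k n j =
             (if j \<ge> int k - int n \<and> even k \<and> even (int (n - k) - j)
              then 2 * real_of_int \<bar>j\<bar> *
                (\<Sum>i \<in> {i::nat. \<bar>j\<bar> \<le> int i \<and> i \<le> n - k \<and> even (int i + j)}.
                   a_coeff (n - i) / real i * real (i choose nat ((int i + j) div 2))
                   * p ^ nat ((int n + j) div 2) * q ^ nat ((int n - j) div 2))
              else 0))"
proof -
  interpret prob_space M by fact
  have jp: "joint_prob M X k n j =
      path_count k n j * (p powi ((int n + j) div 2) * q powi ((int n - j) div 2))"
    using assms(2-4) by (intro joint_prob_eq_path_count assms(5-7)) auto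
  define w where "w = p ^ nat ((int n + j) div 2) * q ^ nat ((int n - j) div 2)"
  \<comment> \<open>In this range the exponents are nonnegative; in the zero branches below the
    count itself vanishes.\<close>
  have w: "p powi ((int n + j) div 2) * q powi ((int n - j) div 2) = w" if "\<bar>j\<bar> \<le> int n"
    using that by (simp add: w_def power_int_def)
  show ?thesis
  proof (intro conjI impI)
    assume A: "j \<ge> 1 \<and> even (n - k)"
    then obtain m where m: "j = int m" "0 < m" by (metis zero_less_imp_eq_int zless_iff_Suc_zadd int_one_le_iff_zero_less)
    have pc: "path_count k n j = last_zero_sum k n m"
      using A m \<open>k \<le> n\<close> by (simp add: path_count_def)
    have even_nk: "even n \<longleftrightarrow> even k" using A \<open>k \<le> n\<close> by simp
    show "joint_prob M X k n j =
             (if j \<le> int k \<and> even (int k - j)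
              then 2 * real_of_int j *
                (\<Sum>i \<in> {i::nat. j \<le> int i \<and> i \<le> k \<and> even (int i - j)}.
                   a_coeff (n - i) / real i * real (i choose nat ((int i + j) div 2))
                   * p ^ nat ((int n + j) div 2) * q ^ nat ((int n - j) div 2))
              else 0)"
    proof (cases "j \<le> int k \<and> even (int k - j)")
      case True
      have "path_count k n j = (\<Sum>i | m \<le> i \<and> i \<le> k \<and> even (i + m). 2 * a_coeff (n - i) * ballot i m)"
        unfolding pc using True even_nk m \<open>k \<le> n\<close> by (intro last_zero_sum_eq) auto
      also have "\<dots> = (\<Sum>i \<in> {i::nat. j \<le> int i \<and> i \<le> k \<and> even (int i - j)}.
          2 * real_of_int j * (a_coeff (n - i) / real i * real (i choose nat ((int i + j) div 2))))"
      proof (rule sum.cong)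
        fix i assume "i \<in> {i::nat. j \<le> int i \<and> i \<le> k \<and> even (int i - j)}"
        then have "0 < i" "m \<le> i" "even (i + m)" using m by auto
        moreover have "nat ((int i + j) div 2) = (i + m) div 2" using m by (simp add: nat_div_distrib nat_add_distrib)
        ultimately show "2 * a_coeff (n - i) * ballot i m =
            2 * real_of_int j * (a_coeff (n - i) / real i * real (i choose nat ((int i + j) div 2)))"
          using ballot_eq(2)[of i m] m by simp
      qed (use m in auto)
      finally show ?thesis
        using True w A \<open>k \<le> n\<close> unfolding jp if_P[OF True]
        by (simp add: w_def sum_distrib_left sum_distrib_right mult.assoc)
    next
      case False
      then have "path_count k n j = 0"
        unfolding pc using even_nk m \<open>k \<le> n\<close> last_zero_sum_less[of k m n] last_zero_sum_eq_0[of n m k]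
        by auto
      then show ?thesis unfolding if_not_P[OF False] by (simp add: jp)
    qed
  next
    assume A: "j \<le> - 1 \<and> (even (n - k) \<or> even k)"
    then obtain m where m: "j = - int m" "0 < m"
      by (metis zero_less_imp_eq_int minus_equation_iff neg_le_iff_le int_one_le_iff_zero_less)
    have pc: "path_count k n j = (if even k then last_zero_sum (n - k) n m else 0)"
      using A m \<open>k \<le> n\<close> by (simp add: path_count_def)
    show "joint_prob M X k n j =
             (if j \<ge> int k - int n \<and> even k \<and> even (int (n - k) - j)
              then 2 * real_of_int \<bar>j\<bar> *
                (\<Sum>i \<in> {i::nat. \<bar>j\<bar> \<le> int i \<and> i \<le> n - k \<and> even (int i + j)}.
                   a_coeff (n - i) / real i * real (i choose nat ((int i + j) div 2))
                   * p ^ nat ((int n + j) div 2) * q ^ nat ((int n - j) div 2))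
              else 0)"
    proof (cases "j \<ge> int k - int n \<and> even k \<and> even (int (n - k) - j)")
      case True
      have "path_count k n j =
          (\<Sum>i | m \<le> i \<and> i \<le> n - k \<and> even (i + m). 2 * a_coeff (n - i) * ballot i m)"
        unfolding pc using True m \<open>k \<le> n\<close> by (subst last_zero_sum_eq) auto
      also have "\<dots> = (\<Sum>i \<in> {i::nat. \<bar>j\<bar> \<le> int i \<and> i \<le> n - k \<and> even (int i + j)}.
          2 * real_of_int \<bar>j\<bar> * (a_coeff (n - i) / real i * real (i choose nat ((int i + j) div 2))))"
      proof (rule sum.cong)
        fix i assume "i \<in> {i::nat. \<bar>j\<bar> \<le> int i \<and> i \<le> n - k \<and> even (int i + j)}"
        then have i: "0 < i" "m \<le> i" "even (i + m)" using m by auto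
        then have "nat ((int i + j) div 2) = (i - m) div 2"
          using m by (simp add: nat_div_distrib nat_diff_distrib)
        with i show "2 * a_coeff (n - i) * ballot i m =
            2 * real_of_int \<bar>j\<bar> * (a_coeff (n - i) / real i * real (i choose nat ((int i + j) div 2)))"
          using ballot_eq(1)[of i m] m by simp
      qed (use m in auto)
      finally show ?thesis
        using True w A \<open>k \<le> n\<close> unfolding jp if_P[OF True]
        by (simp add: w_def sum_distrib_left sum_distrib_right mult.assoc)
    next
      case False
      then have "path_count k n j = 0"
        unfolding pc using m \<open>k \<le> n\<close> last_zero_sum_less[of "n - k" m n] last_zero_sum_eq_0[of n m "n - k"]
        by auto
      then show ?thesis unfolding if_not_P[OF False] by (simp add: jp)
    qed
  qed
qed

end
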